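(* Let $\Sigma$ be a finite character alphabet (e.g. Unicode), let $B$ be the alphabet of bytes, let $e:\Sigma^*\to B^*$ be a finite-length character encoding scheme (such as UTF-8), and consider a byte-level tokenizer with token ID alphabet $\mathbb{N}=\{0,1,\dots,|V|-1\}$. Let $L\subseteq\Sigma^*$ be a source language, let $L_b=e(L)\subseteq B^*$ be its byte-level language, and let $L_t\subseteq\mathbb{N}^*$ be the token language, i.e. the image of $L_b$ under the extended byte-level tokenization function. If $L$ is context-free (respectively regular), then $L_b$ and $L_t$ are both context-free (respectively regular).
   Context: Here $\mathbb{N}$ does not denote the natural numbers. $B=\{0,1,\dots,255\}$. A finite-length character encoding scheme replaces each character of $\Sigma$ by a fixed finite byte sequence, and a string is encoded by concatenating the encodings of its characters: $e(c_1\cdots c_m)=e(c_1)\cdots e(c_m)$. A byte-level tokenizer has a finite vocabulary $V$ of tokens, which are byte strings in $B^*$, indexed by the token IDs in the finite alphabet $\mathbb{N}=\{0,1,\dots,|V|-1\}$; let $\tau:\mathbb{N}\to B^*$ send each token ID to its token. The extended byte-level tokenization function maps $b\in B^*$ to the set $F_{\text{tok}}(b)$ of all its valid tokenizations, i.e. of all $n_1\cdots n_k\in\mathbb{N}^*$ with $\tau(n_1)\cdots\tau(n_k)=b$, and $L_t=\bigcup_{b\in L_b}F_{\text{tok}}(b)$. *)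

theory Defs
  imports Main
begin

text \<open>
  A word over an alphabet \<open>A\<close> is an element of \<open>lists A\<close>. Alphabets are explicit finite sets rather
  than types, because the token ID alphabet depends on the size of the vocabulary.
\<close>

subsection \<open>Context-free languages\<close>

datatype ('n, 't) symbol = Nt 'n | Tm 't

record ('n, 't) cfg =
  nonterminals :: "'n set"
  productions :: "('n \<times> ('n, 't) symbol list) set"
  start :: 'n

definition wf_cfg :: "'t set \<Rightarrow> ('n, 't) cfg \<Rightarrow> bool" where
  "wf_cfg A G \<longleftrightarrow>
     finite (nonterminals G) \<and> start G \<in> nonterminals G \<and> finite (productions G) \<and>
     productions G \<subseteq> nonterminals G \<times> lists (Nt ` nonterminals G \<union> Tm ` A)"

inductive derives1 ::
  "('n, 't) cfg \<Rightarrow> ('n, 't) symbol list \<Rightarrow> ('n, 't) symbol list \<Rightarrow> bool" for G where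
  "(X, \<alpha>) \<in> productions G \<Longrightarrow> derives1 G (u @ [Nt X] @ v) (u @ \<alpha> @ v)"

definition cfg_language :: "('n, 't) cfg \<Rightarrow> 't list set" where
  "cfg_language G = {w. (derives1 G)\<^sup>*\<^sup>* [Nt (start G)] (map Tm w)}"

text \<open>
  A grammar has only finitely many nonterminals, so drawing their names from \<^typ>\<open>nat\<close> is no
  restriction. The same applies to the states of an automaton below.
\<close>

definition context_free :: "'t set \<Rightarrow> 't list set \<Rightarrow> bool" where
  "context_free A L \<longleftrightarrow> (\<exists>G :: (nat, 't) cfg. wf_cfg A G \<and> L = cfg_language G)"

subsection \<open>Regular languages\<close>

record ('q, 't) dfa =
  states :: "'q set"
  trans_fun :: "'q \<Rightarrow> 't \<Rightarrow> 'q"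
  init :: 'q
  final :: "'q set"

definition wf_dfa :: "'t set \<Rightarrow> ('q, 't) dfa \<Rightarrow> bool" where
  "wf_dfa A M \<longleftrightarrow>
     finite (states M) \<and> init M \<in> states M \<and> final M \<subseteq> states M \<and>
     (\<forall>q\<in>states M. \<forall>a\<in>A. trans_fun M q a \<in> states M)"

definition dfa_language :: "'t set \<Rightarrow> ('q, 't) dfa \<Rightarrow> 't list set" where
  "dfa_language A M = {w \<in> lists A. foldl (trans_fun M) (init M) w \<in> final M}"

definition regular :: "'t set \<Rightarrow> 't list set \<Rightarrow> bool" where
  "regular A L \<longleftrightarrow> (\<exists>M :: (nat, 't) dfa. wf_dfa A M \<and> L = dfa_language A M)"

subsection \<open>Character encodings and byte-level tokenizers\<close>

definition bytes :: "nat set" where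
  "bytes = {0..255}"

definition encoding_scheme :: "'c set \<Rightarrow> ('c \<Rightarrow> nat list) \<Rightarrow> bool" where
  "encoding_scheme \<Sigma> enc \<longleftrightarrow> (\<forall>c\<in>\<Sigma>. enc c \<in> lists bytes)"

definition encode :: "('c \<Rightarrow> nat list) \<Rightarrow> 'c list \<Rightarrow> nat list" where
  "encode enc w = concat (map enc w)"

definition byte_language :: "('c \<Rightarrow> nat list) \<Rightarrow> 'c list set \<Rightarrow> nat list set" where
  "byte_language enc L = encode enc ` L"

definition token_ids :: "nat list set \<Rightarrow> nat set" where
  "token_ids V = {0..<card V}"

definition byte_level_tokenizer :: "nat list set \<Rightarrow> (nat \<Rightarrow> nat list) \<Rightarrow> bool" where
  "byte_level_tokenizer V \<tau> \<longleftrightarrow>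
     finite V \<and> V \<subseteq> lists bytes \<and> bij_betw \<tau> (token_ids V) V"

definition tokenizations :: "nat list set \<Rightarrow> (nat \<Rightarrow> nat list) \<Rightarrow> nat list \<Rightarrow> nat list set" where
  "tokenizations V \<tau> b = {ns \<in> lists (token_ids V). concat (map \<tau> ns) = b}"

definition token_language ::
  "nat list set \<Rightarrow> (nat \<Rightarrow> nat list) \<Rightarrow> nat list set \<Rightarrow> nat list set" where
  "token_language V \<tau> L\<^sub>b = (\<Union>b\<in>L\<^sub>b. tokenizations V \<tau> b)"

end

theory Submission
  imports Defs "HOL-Library.Sublist"
begin

text \<open>
  The encoding is a homomorphism, and the token language is the preimage of the byte language under
  the homomorphism \<open>h\<close> extending \<open>\<tau>\<close>; either of them may erase letters. A regular language
  is one with finitely many left quotients, and quotients of images and preimages are controlled by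
  quotients of the original language. A preimage of a context-free language is generated by a
  grammar with nonterminals \<open>(s, \<alpha>, s')\<close>, where \<open>s\<close> and \<open>s'\<close> are buffers of bounded length and
  \<open>\<alpha>\<close> is a suffix of a right-hand side: \<open>(s, \<alpha>, s')\<close> generates the words \<open>x\<close> with
  \<open>s @ h x = w @ s'\<close> for some \<open>w\<close> derivable from \<open>\<alpha>\<close>.
\<close>

section \<open>Cutting the image of a word at an arbitrary position\<close>

section \<open>Homomorphisms\<close>

abbreviation hom_ext :: "('a \<Rightarrow> 'b list) \<Rightarrow> 'a list \<Rightarrow> 'b list" where
  "hom_ext h x \<equiv> concat (map h x)"

lemma hom_ext_in_lists: "h ` D \<subseteq> lists A \<Longrightarrow> x \<in> lists D \<Longrightarrow> hom_ext h x \<in> lists A"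
  by fastforce

text \<open>The cut after \<open>u\<close> may fall inside the image of a single letter. That letter
  is then put into \<open>x\<close>, and \<open>s\<close> is the rest of its image, so its length is
  bounded by \<open>N\<close>; at a cut between letters \<open>s\<close> can be empty.\<close>

lemma hom_ext_split:
  assumes "\<And>c. c \<in> set z \<Longrightarrow> length (h c) \<le> N" and "u @ v = hom_ext h z"
  shows "\<exists>x y s. z = x @ y \<and> hom_ext h x = u @ s \<and> v = s @ hom_ext h y \<and> length s \<le> N"
  using assms
proof (induction z arbitrary: u)
  case Nil
  then show ?case by simp
next
  case (Cons c z)
  show ?case
  proof (cases "u = []")
    case True
    then show ?thesis using Cons.prems(2) by (intro exI[of _ "[]"] exI[of _ "c # z"]) simp
  next
    case False
    from Cons.prems(2) have "u @ v = h c @ hom_ext h z" by simp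
    then consider (long) u' where "u = h c @ u'" "u' @ v = hom_ext h z"
      | (short) s where "h c = u @ s" "v = s @ hom_ext h z"
      unfolding append_eq_append_conv2 by metis
    then show ?thesis
    proof cases
      case long
      obtain x y s where "z = x @ y" "hom_ext h x = u' @ s" "v = s @ hom_ext h y" "length s \<le> N"
        using Cons.IH[OF _ long(2)] Cons.prems(1) by auto
      then show ?thesis
        using long(1) by (intro exI[of _ "c # x"] exI[of _ y] exI[of _ s]) simp
    next
      case short
      have "length s \<le> N" using Cons.prems(1)[of c] short(1) by simp
      then show ?thesis
        using short by (intro exI[of _ "[c]"] exI[of _ z] exI[of _ s]) simp
    qed
  qed
qed

text \<open>The same cut with pending input \<open>s\<close> in front. If \<open>u\<close> ends
  inside \<open>s\<close>, no letter is read and the rest of \<open>s\<close> stays pending;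
  otherwise the cut lies in the image of \<open>z\<close>.\<close>

lemma hom_ext_split_buffer:
  assumes "\<And>c. c \<in> set z \<Longrightarrow> length (h c) \<le> N" and "length s \<le> N" and "s @ hom_ext h z = u @ v"
  shows "\<exists>x y t. z = x @ y \<and> s @ hom_ext h x = u @ t \<and> v = t @ hom_ext h y \<and> length t \<le> N"
proof -
  from assms(3) consider (long) u' where "u = s @ u'" "u' @ v = hom_ext h z"
    | (short) t where "s = u @ t" "v = t @ hom_ext h z"
    unfolding append_eq_append_conv2 by metis
  then show ?thesis
  proof cases
    case long
    then show ?thesis using hom_ext_split[OF assms(1) long(2)] by fastforce
  next
    case short
    then show ?thesis
      using assms(2) by (intro exI[of _ "[]"] exI[of _ z] exI[of _ t]) simp
  qed
qed

lemma finite_imp_bounded_length: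
  assumes "finite D"
  obtains N where "\<And>c. c \<in> D \<Longrightarrow> length (h c) \<le> N"
  using finite_nat_set_iff_bounded_le[of "(\<lambda>c. length (h c)) ` D"] assms by auto

section \<open>Regularity by finiteness of left quotients, with closure under images and
  preimages\<close>

section \<open>Regular languages\<close>

definition left_quotient :: "'t list set \<Rightarrow> 't list \<Rightarrow> 't list set" where
  "left_quotient L u = {v. u @ v \<in> L}"

lemma left_quotient_Nil [simp]: "left_quotient L [] = L"
  by (simp add: left_quotient_def)

lemma left_quotient_append: "left_quotient L (u @ v) = left_quotient (left_quotient L u) v"
  by (simp add: left_quotient_def)

lemma foldl_trans_fun_in_states:
  "wf_dfa A M \<Longrightarrow> q \<in> states M \<Longrightarrow> w \<in> lists A \<Longrightarrow> foldl (trans_fun M) q w \<in> states M"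
  by (induction w arbitrary: q) (auto simp: wf_dfa_def)

text \<open>The quotient by \<open>u\<close> depends only on the state that \<open>u\<close>
  reaches.\<close>

lemma regular_imp_finite_left_quotients:
  assumes "regular A L"
  shows "finite (left_quotient L ` lists A)"
proof -
  obtain M :: "(nat, 'a) dfa" where wf: "wf_dfa A M" and L: "L = dfa_language A M"
    using assms by (auto simp: regular_def)
  let ?lang = "\<lambda>q. {v \<in> lists A. foldl (trans_fun M) q v \<in> final M}"
  have "left_quotient L u = ?lang (foldl (trans_fun M) (init M) u)" if "u \<in> lists A" for u
    using that by (auto simp: left_quotient_def L dfa_language_def)
  moreover have "foldl (trans_fun M) (init M) u \<in> states M" if "u \<in> lists A" for u
    using that wf by (intro foldl_trans_fun_in_states) (auto simp: wf_dfa_def)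
  ultimately have "left_quotient L ` lists A \<subseteq> ?lang ` states M"
    by blast
  moreover have "finite (states M)" using wf by (simp add: wf_dfa_def)
  ultimately show ?thesis by (meson finite_imageI finite_subset)
qed

text \<open>As in the Myhill-Nerode theorem, the quotients themselves serve as states: reading a
  letter takes a further quotient, and a quotient is accepting iff it contains the empty
  word.\<close>

lemma finite_left_quotients_imp_regular:
  assumes sub: "L \<subseteq> lists A" and fin: "finite (left_quotient L ` lists A)"
  shows "regular A L"
proof -
  let ?Q = "left_quotient L ` lists A"
  obtain f :: "'a list set \<Rightarrow> nat" where f: "inj_on f ?Q"
    using finite_imp_inj_to_nat_seg[OF fin] by blast
  \<comment> \<open>\<open>f\<close> numbers the quotients because \<open>regular\<close> asks for
    states of type \<open>nat\<close>; \<open>inv_into ?Q f\<close> decodes a number before the next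
    quotient is taken.\<close>
  define M where "M = \<lparr>states = f ` ?Q,
      trans_fun = (\<lambda>q a. f (left_quotient (inv_into ?Q f q) [a])),
      init = f L, final = f ` {K \<in> ?Q. [] \<in> K}\<rparr>"
  have L: "L \<in> ?Q"
    by (metis image_eqI left_quotient_Nil lists.Nil)
  have closed: "left_quotient K [a] \<in> ?Q" if "K \<in> ?Q" "a \<in> A" for K a
  proof -
    obtain u where "u \<in> lists A" "K = left_quotient L u" using \<open>K \<in> ?Q\<close> by blast
    then have "left_quotient K [a] = left_quotient L (u @ [a])" "u @ [a] \<in> lists A"
      using \<open>a \<in> A\<close> by (simp_all add: left_quotient_append)
    then show ?thesis by blast
  qed
  have step: "trans_fun M (f K) a = f (left_quotient K [a])" if "K \<in> ?Q" for K a
    using that f by (simp add: M_def)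
  have run: "foldl (trans_fun M) (f K) w = f (left_quotient K w) \<and> left_quotient K w \<in> ?Q"
    if "K \<in> ?Q" "w \<in> lists A" for K w
    using that
  proof (induction w arbitrary: K)
    case Nil
    then show ?case by simp
  next
    case (Cons a w)
    have a: "a \<in> A" "w \<in> lists A" using Cons.prems by auto
    show ?case
      using Cons.IH[OF closed[OF Cons.prems(1) a(1)] a(2)] step[OF Cons.prems(1)]
        left_quotient_append[of K "[a]" w]
      by simp
  qed
  have "trans_fun M q a \<in> states M" if q: "q \<in> states M" and a: "a \<in> A" for q a
  proof -
    obtain K where "K \<in> ?Q" "q = f K" using q by (auto simp: M_def)
    then have "trans_fun M q a \<in> f ` ?Q" using step closed a by simp
    then show ?thesis by (simp add: M_def)
  qed
  then have "wf_dfa A M"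
    using fin L by (auto simp: wf_dfa_def M_def)
  moreover have "foldl (trans_fun M) (init M) w \<in> final M \<longleftrightarrow> w \<in> L" if "w \<in> lists A" for w
  proof -
    have r: "foldl (trans_fun M) (init M) w = f (left_quotient L w)" "left_quotient L w \<in> ?Q"
      using run[OF L that] by (simp_all add: M_def)
    have "f (left_quotient L w) \<in> final M \<longleftrightarrow> [] \<in> left_quotient L w"
      using inj_on_image_mem_iff[OF f r(2)] r(2) by (simp add: M_def)
    then show ?thesis by (simp add: r(1) left_quotient_def)
  qed
  ultimately show ?thesis
    unfolding regular_def dfa_language_def using sub by (intro exI[of _ M]) auto
qed

lemma regular_subset_lists: "regular A L \<Longrightarrow> L \<subseteq> lists A"
  by (auto simp: regular_def dfa_language_def)

text \<open>After a prefix \<open>u\<close> of an image, all that matters is which overhangs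
  \<open>s\<close> are possible and which quotient of \<open>L\<close> remains in each case. So
  every \<open>u\<close> determines a subset of one fixed finite set, and equal subsets give equal
  quotients.\<close>

lemma regular_hom_image:
  assumes "finite D" and "finite A" and h: "h ` D \<subseteq> lists A" and reg: "regular D L"
  shows "regular A (hom_ext h ` L)"
proof (rule finite_left_quotients_imp_regular)
  have LD: "L \<subseteq> lists D" using reg by (rule regular_subset_lists)
  then show "hom_ext h ` L \<subseteq> lists A"
    using hom_ext_in_lists[OF h] by blast
  obtain N where N: "\<And>c. c \<in> D \<Longrightarrow> length (h c) \<le> N"
    using finite_imp_bounded_length[OF \<open>finite D\<close>] by blast
  define W where "W = {s. set s \<subseteq> A \<and> length s \<le> N}"
  have W: "finite W" using \<open>finite A\<close> by (simp add: W_def finite_lists_length_le)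
  \<comment> \<open>A set of pairs is recorded because several words \<open>x\<close> may cover the
    same \<open>u\<close> and leave different quotients of \<open>L\<close>.\<close>
  define R where "R u = {(s, K). s \<in> W \<and> (\<exists>x \<in> lists D. hom_ext h x = u @ s \<and> K = left_quotient L x)}"
    for u
  have "R u \<subseteq> W \<times> left_quotient L ` lists D" for u
    by (auto simp: R_def)
  then have "range R \<subseteq> Pow (W \<times> left_quotient L ` lists D)"
    by blast
  then have finR: "finite (range R)"
    using W regular_imp_finite_left_quotients[OF reg]
    by (meson finite_Pow_iff finite_SigmaI finite_subset)
  have quot: "left_quotient (hom_ext h ` L) u = (\<Union>(s, K)\<in>R u. (\<lambda>y. s @ hom_ext h y) ` K)" for u
  proof (intro equalityI subsetI)
    fix v assume "v \<in> left_quotient (hom_ext h ` L) u"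
    then obtain z where z: "z \<in> L" "u @ v = hom_ext h z" by (auto simp: left_quotient_def)
    have zD: "set z \<subseteq> D" using z(1) LD by auto
    obtain x y s where xys: "z = x @ y" "hom_ext h x = u @ s" "v = s @ hom_ext h y" "length s \<le> N"
      using hom_ext_split[OF _ z(2), of N] N zD by blast
    have "hom_ext h x \<in> lists A" "x \<in> lists D"
      using hom_ext_in_lists[OF h, of x] zD xys(1) by auto
    then have "(s, left_quotient L x) \<in> R u" "y \<in> left_quotient L x"
      using xys z(1) by (auto simp: R_def W_def left_quotient_def)
    then show "v \<in> (\<Union>(s, K)\<in>R u. (\<lambda>y. s @ hom_ext h y) ` K)"
      using xys(3) by blast
  next
    fix v assume "v \<in> (\<Union>(s, K)\<in>R u. (\<lambda>y. s @ hom_ext h y) ` K)"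
    then obtain s x y where "hom_ext h x = u @ s" "x @ y \<in> L" "v = s @ hom_ext h y"
      by (auto simp: R_def left_quotient_def)
    then have "u @ v = hom_ext h (x @ y)" by simp
    then show "v \<in> left_quotient (hom_ext h ` L) u"
      using \<open>x @ y \<in> L\<close> unfolding left_quotient_def by blast
  qed
  have "left_quotient (hom_ext h ` L) ` lists A
      \<subseteq> (\<lambda>r. \<Union>(s, K)\<in>r. (\<lambda>y. s @ hom_ext h y) ` K) ` range R"
    using quot by blast
  then show "finite (left_quotient (hom_ext h ` L) ` lists A)"
    using finR by (meson finite_imageI finite_subset)
qed

text \<open>Quotients commute with preimages: the quotient of the preimage by \<open>u\<close> is
  the preimage of the quotient by \<open>hom_ext h u\<close>.\<close>

lemma regular_hom_preimage:
  assumes h: "h ` D \<subseteq> lists A" and reg: "regular A K"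
  shows "regular D {x \<in> lists D. hom_ext h x \<in> K}"
proof (rule finite_left_quotients_imp_regular)
  let ?pre = "\<lambda>K. {x \<in> lists D. hom_ext h x \<in> K}"
  have "left_quotient (?pre K) u = ?pre (left_quotient K (hom_ext h u))" if "u \<in> lists D" for u
    using that by (auto simp: left_quotient_def)
  moreover have "hom_ext h u \<in> lists A" if "u \<in> lists D" for u
    using that hom_ext_in_lists[OF h] by blast
  ultimately have "left_quotient (?pre K) ` lists D \<subseteq> ?pre ` left_quotient K ` lists A"
    by (intro image_subsetI) simp
  then show "finite (left_quotient (?pre K) ` lists D)"
    using regular_imp_finite_left_quotients[OF reg] by (meson finite_imageI finite_subset)
qed auto

section \<open>Derivations of terminal words as derivation trees\<close>

section \<open>Big-step derivations\<close>

text \<open>Whole derivation trees replace sequences of rewriting steps, so that inductions can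
  follow the structure of a sentential form.\<close>

inductive yields ::
  "('n \<times> ('n, 't) symbol list) set \<Rightarrow> ('n, 't) symbol list \<Rightarrow> 't list \<Rightarrow> bool" for P where
  yields_Nil: "yields P [] []"
| yields_Tm: "yields P \<alpha> w \<Longrightarrow> yields P (Tm a # \<alpha>) (a # w)"
| yields_Nt: "(X, \<beta>) \<in> P \<Longrightarrow> yields P \<beta> u \<Longrightarrow> yields P \<alpha> v \<Longrightarrow> yields P (Nt X # \<alpha>) (u @ v)"

inductive_cases yields_NilE: "yields P [] w"
inductive_cases yields_TmE: "yields P (Tm a # \<alpha>) w"
inductive_cases yields_NtE: "yields P (Nt X # \<alpha>) w"

lemma yields_append: "yields P \<alpha> u \<Longrightarrow> yields P \<beta> v \<Longrightarrow> yields P (\<alpha> @ \<beta>) (u @ v)"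
  by (induction rule: yields.induct) (auto intro: yields.intros)

lemma yields_appendE:
  assumes "yields P (\<alpha> @ \<beta>) w"
  obtains u v where "w = u @ v" "yields P \<alpha> u" "yields P \<beta> v"
proof -
  have "\<exists>u v. w = u @ v \<and> yields P \<alpha> u \<and> yields P \<beta> v"
    using assms
  proof (induction "\<alpha> @ \<beta>" w arbitrary: \<alpha> rule: yields.induct)
    case yields_Nil
    then show ?case by (auto intro: yields.intros)
  next
    case (yields_Tm \<gamma> w a)
    show ?case
    proof (cases \<alpha>)
      case Nil
      then show ?thesis using yields_Tm by (metis append_Nil yields.intros)
    next
      case (Cons b \<alpha>')
      then show ?thesis using yields_Tm by (metis append_Cons list.inject yields.intros(2))
    qed
  next
    case (yields_Nt X \<delta> u \<gamma> v)
    show ?case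
    proof (cases \<alpha>)
      case Nil
      then show ?thesis using yields_Nt by (metis append_Nil yields.intros)
    next
      case (Cons b \<alpha>')
      then obtain v1 v2 where "v = v1 @ v2" "yields P \<alpha>' v1" "yields P \<beta> v2" "b = Nt X"
        using yields_Nt by auto
      then show ?thesis
        using Cons yields_Nt(1,2) by (intro exI[of _ "u @ v1"] exI[of _ v2]) (auto intro: yields.intros)
    qed
  qed
  then show ?thesis using that by blast
qed

lemma yields_map_Tm [simp]: "yields P (map Tm w) v \<longleftrightarrow> v = w"
  by (induction w arbitrary: v) (auto intro: yields.intros elim: yields_NilE yields_TmE)

lemma yields_Nt_single: "(X, \<beta>) \<in> P \<Longrightarrow> yields P \<beta> w \<Longrightarrow> yields P [Nt X] w"
  using yields_Nt[of X \<beta> P w "[]" "[]"] yields_Nil by auto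

lemma derives1_context: "derives1 G \<alpha> \<beta> \<Longrightarrow> derives1 G (u @ \<alpha> @ v) (u @ \<beta> @ v)"
proof (induction rule: derives1.induct)
  case (1 X \<gamma> u' v')
  then show ?case using derives1.intros[of X \<gamma> G "u @ u'" "v' @ v"] by simp
qed

lemma derives_context:
  "(derives1 G)\<^sup>*\<^sup>* \<alpha> \<beta> \<Longrightarrow> (derives1 G)\<^sup>*\<^sup>* (u @ \<alpha> @ v) (u @ \<beta> @ v)"
  by (induction rule: rtranclp_induct) (auto intro: rtranclp.rtrancl_into_rtrancl derives1_context)

lemma yields_imp_derives: "yields (productions G) \<alpha> w \<Longrightarrow> (derives1 G)\<^sup>*\<^sup>* \<alpha> (map Tm w)"
proof (induction rule: yields.induct)
  case yields_Nil
  then show ?case by simp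
next
  case (yields_Tm \<alpha> w a)
  then show ?case using derives_context[of G \<alpha> "map Tm w" "[Tm a]" "[]"] by simp
next
  case (yields_Nt X \<beta> u \<alpha> v)
  have "derives1 G (Nt X # \<alpha>) (\<beta> @ \<alpha>)"
    using derives1.intros[OF yields_Nt.hyps(1), of "[]" \<alpha>] by simp
  also have "(derives1 G)\<^sup>*\<^sup>* (\<beta> @ \<alpha>) (map Tm u @ \<alpha>)"
    using derives_context[OF yields_Nt.IH(1), of "[]" \<alpha>] by simp
  also have "(derives1 G)\<^sup>*\<^sup>* (map Tm u @ \<alpha>) (map Tm u @ map Tm v)"
    using derives_context[OF yields_Nt.IH(2), of "map Tm u" "[]"] by simp
  finally show ?case by simp
qed

text \<open>A rewriting step is undone by splitting the word around the replaced occurrence.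
  Repeating this backwards from the terminal word turns a rewriting sequence into a tree.\<close>

lemma derives1_yields:
  assumes "derives1 G \<alpha> \<beta>" "yields (productions G) \<beta> w"
  shows "yields (productions G) \<alpha> w"
  using assms
proof (induction rule: derives1.induct)
  case (1 X \<gamma> u v)
  then obtain a b c where "w = a @ b @ c" "yields (productions G) u a"
      "yields (productions G) \<gamma> b" "yields (productions G) v c"
    by (metis yields_appendE)
  then show ?case using 1(1) by (auto intro: yields_append yields_Nt)
qed

lemma derives_iff_yields: "(derives1 G)\<^sup>*\<^sup>* \<alpha> (map Tm w) \<longleftrightarrow> yields (productions G) \<alpha> w"
proof
  show "yields (productions G) \<alpha> w" if "(derives1 G)\<^sup>*\<^sup>* \<alpha> (map Tm w)"
    using that by (induction rule: converse_rtranclp_induct) (auto intro: derives1_yields)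
qed (rule yields_imp_derives)

section \<open>Bounding a grammar from above by reading nonterminals as languages\<close>

fun in_form :: "('n \<Rightarrow> 't list set) \<Rightarrow> ('n, 't) symbol list \<Rightarrow> 't list \<Rightarrow> bool" where
  "in_form I [] w \<longleftrightarrow> w = []"
| "in_form I (Tm a # \<gamma>) w \<longleftrightarrow> (\<exists>v. w = a # v \<and> in_form I \<gamma> v)"
| "in_form I (Nt X # \<gamma>) w \<longleftrightarrow> (\<exists>u v. w = u @ v \<and> u \<in> I X \<and> in_form I \<gamma> v)"

text \<open>The languages of the nonterminals are the least solution of the inclusions that the
  productions express, so every \<open>I\<close> closed under the productions lies above them.
  Soundness of a constructed grammar thus reduces to one check per kind of production.\<close>

lemma yields_imp_in_form:
  assumes "\<And>X \<beta> u. (X, \<beta>) \<in> P \<Longrightarrow> in_form I \<beta> u \<Longrightarrow> u \<in> I X" and "yields P \<gamma> w"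
  shows "in_form I \<gamma> w"
  using assms(2) by (induction rule: yields.induct) (auto intro: assms(1))

lemma in_form_appendE:
  assumes "in_form I (\<alpha> @ \<beta>) w"
  obtains u v where "w = u @ v" "in_form I \<alpha> u" "in_form I \<beta> v"
proof -
  have "\<exists>u v. w = u @ v \<and> in_form I \<alpha> u \<and> in_form I \<beta> v"
    using assms
  proof (induction I \<alpha> w rule: in_form.induct)
    case (1 I w)
    then show ?case by simp
  next
    case (2 I a \<gamma> w)
    then obtain u v where "w = a # u @ v" "in_form I \<gamma> u" "in_form I \<beta> v"
      by auto blast
    then show ?case by (intro exI[of _ "a # u"] exI[of _ v]) simp
  next
    case (3 I X \<gamma> w)
    then obtain p u v where "w = p @ u @ v" "p \<in> I X" "in_form I \<gamma> u" "in_form I \<beta> v"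
      by auto blast
    then show ?case by (intro exI[of _ "p @ u"] exI[of _ v]) auto
  qed
  then show ?thesis using that by blast
qed

lemma in_form_map_Tm [simp]: "in_form I (map Tm u) w \<longleftrightarrow> w = u"
  by (induction u arbitrary: w) auto

section \<open>Grammars up to renaming of nonterminals\<close>

section \<open>Context-free languages\<close>

definition rename_nts :: "('n \<Rightarrow> 'm) \<Rightarrow> ('n \<times> ('n, 't) symbol list) set \<Rightarrow> ('m \<times> ('m, 't) symbol list) set"
  where "rename_nts f P = (\<lambda>(X, \<beta>). (f X, map (map_symbol f id) \<beta>)) ` P"

lemma yields_rename: "yields P \<alpha> w \<Longrightarrow> yields (rename_nts f P) (map (map_symbol f id) \<alpha>) w"
proof (induction rule: yields.induct)
  case (yields_Nt X \<beta> u \<alpha> v)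
  have "(f X, map (map_symbol f id) \<beta>) \<in> rename_nts f P"
    unfolding rename_nts_def using yields_Nt.hyps(1) by force
  from yields.yields_Nt[OF this yields_Nt.IH] show ?case by simp
qed (auto intro: yields.intros)

definition nts_of :: "('n \<times> ('n, 't) symbol list) set \<Rightarrow> 'n set" where
  "nts_of P = fst ` P \<union> (\<Union>(X, \<beta>)\<in>P. Nt -` set \<beta>)"

lemma finite_nts_of: "finite P \<Longrightarrow> finite (nts_of P)"
  by (auto simp: nts_of_def intro!: finite_vimageI injI)

text \<open>Decoding the names is itself a renaming, so \<open>yields_rename\<close> also serves for
  the way back.\<close>

lemma rename_nts_inverse:
  assumes "\<And>X. X \<in> nts_of P \<Longrightarrow> g (f X) = X"
  shows "rename_nts g (rename_nts f P) = P"
proof -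
  have "(g (f X), map (map_symbol g id) (map (map_symbol f id) \<beta>)) = (X, \<beta>)" if "(X, \<beta>) \<in> P" for X \<beta>
  proof -
    have "map_symbol g id (map_symbol f id x) = x" if "x \<in> set \<beta>" for x
    proof (cases x)
      case (Nt Y)
      then have "Y \<in> nts_of P" using that \<open>(X, \<beta>) \<in> P\<close> unfolding nts_of_def by blast
      then show ?thesis using assms Nt by simp
    qed simp
    moreover have "g (f X) = X"
      using that assms by (force simp: nts_of_def)
    ultimately show ?thesis by (simp add: map_idI)
  qed
  then show ?thesis
    unfolding rename_nts_def image_image by (force simp: image_iff)
qed

text \<open>This admits nonterminals of any type, such as the triples used for preimages: only
  finitely many occur, and these are numbered to meet the definition of
  \<open>context_free\<close>.\<close>

lemma context_freeI:
  fixes P :: "('n \<times> ('n, 't) symbol list) set"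
  assumes fin: "finite P" and tms: "\<And>X \<beta>. (X, \<beta>) \<in> P \<Longrightarrow> set \<beta> \<subseteq> range Nt \<union> Tm ` A"
  shows "context_free A {w. yields P [Nt S] w}"
proof -
  \<comment> \<open>\<open>S\<close> is inserted because it might occur in no production, while
    \<open>wf_cfg\<close> requires the start symbol to be a nonterminal.\<close>
  define N where "N = insert S (nts_of P)"
  have finN: "finite N"
    by (simp add: N_def finite_nts_of fin)
  obtain f :: "'n \<Rightarrow> nat" where f: "inj_on f N"
    using finite_imp_inj_to_nat_seg[OF finN] by blast
  define G where "G = \<lparr>nonterminals = f ` N, productions = rename_nts f P, start = f S\<rparr>"
  have "set \<beta> \<subseteq> Nt ` N \<union> Tm ` A" if "(X, \<beta>) \<in> P" for X \<beta>
    using that tms[OF that] by (force simp: N_def nts_of_def)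
  then have "set (map (map_symbol f id) \<beta>) \<subseteq> Nt ` f ` N \<union> Tm ` A" if "(X, \<beta>) \<in> P" for X \<beta>
    using that by fastforce
  then have "map (map_symbol f id) \<beta> \<in> lists (Nt ` f ` N \<union> Tm ` A)" if "(X, \<beta>) \<in> P" for X \<beta>
    using that by (simp only: lists_eq_set mem_Collect_eq)
  moreover have "X \<in> N" if "(X, \<beta>) \<in> P" for X \<beta>
    using that by (force simp: N_def nts_of_def)
  ultimately have rename:
    "(f X, map (map_symbol f id) \<beta>) \<in> f ` N \<times> lists (Nt ` f ` N \<union> Tm ` A)" if "(X, \<beta>) \<in> P" for X \<beta>
    using that by (meson SigmaI imageI)
  have "rename_nts f P \<subseteq> f ` N \<times> lists (Nt ` f ` N \<union> Tm ` A)"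
    unfolding rename_nts_def
  proof (rule image_subsetI)
    show "(case p of (X, \<beta>) \<Rightarrow> (f X, map (map_symbol f id) \<beta>)) \<in> f ` N \<times> lists (Nt ` f ` N \<union> Tm ` A)"
      if "p \<in> P" for p
      using that rename by (cases p) (simp only: prod.case)
  qed
  then have "wf_cfg A G"
    using fin finN by (simp add: wf_cfg_def G_def N_def rename_nts_def)
  moreover have "yields P [Nt S] w \<longleftrightarrow> yields (rename_nts f P) [Nt (f S)] w" for w
  proof
    show "yields (rename_nts f P) [Nt (f S)] w" if "yields P [Nt S] w"
      using yields_rename[OF that, of f] by simp
    show "yields P [Nt S] w" if "yields (rename_nts f P) [Nt (f S)] w"
      using yields_rename[OF that, of "inv_into N f"] f rename_nts_inverse[of P "inv_into N f" f]
      by (simp add: N_def)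
  qed
  then have "{w. yields P [Nt S] w} = cfg_language G"
    by (simp add: cfg_language_def derives_iff_yields G_def)
  ultimately show ?thesis unfolding context_free_def by blast
qed

lemma context_freeE:
  assumes "context_free A L"
  obtains P :: "(nat \<times> (nat, 't) symbol list) set" and S where "finite P"
    "\<And>X \<beta>. (X, \<beta>) \<in> P \<Longrightarrow> set \<beta> \<subseteq> range Nt \<union> Tm ` A" "L = {w. yields P [Nt S] w}"
proof -
  obtain G :: "(nat, 't) cfg" where G: "wf_cfg A G" "L = cfg_language G"
    using assms by (auto simp: context_free_def)
  have "set \<beta> \<subseteq> range Nt \<union> Tm ` A" if "(X, \<beta>) \<in> productions G" for X \<beta>
  proof -
    have "\<beta> \<in> lists (Nt ` nonterminals G \<union> Tm ` A)" using that G(1) by (auto simp: wf_cfg_def)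
    then show ?thesis by auto
  qed
  moreover have "finite (productions G)" using G(1) by (simp add: wf_cfg_def)
  moreover have "L = {w. yields (productions G) [Nt (start G)] w}"
    using G(2) by (simp add: cfg_language_def derives_iff_yields)
  ultimately show ?thesis using that by blast
qed

lemma yields_set_subset:
  assumes "\<And>X \<beta>. (X, \<beta>) \<in> P \<Longrightarrow> set \<beta> \<subseteq> range Nt \<union> Tm ` A"
    and "yields P \<alpha> w" and "set \<alpha> \<subseteq> range Nt \<union> Tm ` A"
  shows "w \<in> lists A"
  using assms(2,3)
proof (induction rule: yields.induct)
  case (yields_Nt X \<beta> u \<alpha> v)
  then show ?case using assms(1)[OF yields_Nt.hyps(1)] by auto
qed auto

section \<open>Homomorphic images of context-free languages\<close>

fun subst_tm :: "('a \<Rightarrow> 'b list) \<Rightarrow> ('n, 'a) symbol \<Rightarrow> ('n, 'b) symbol list" where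
  "subst_tm h (Nt X) = [Nt X]"
| "subst_tm h (Tm a) = map Tm (h a)"

text \<open>Every terminal of a right-hand side is replaced by its image. Derivation trees carry
  over directly; for the converse, each nonterminal is interpreted as the image of its original
  language.\<close>

lemma context_free_hom_image:
  fixes h :: "'c \<Rightarrow> 'b list"
  assumes h: "h ` D \<subseteq> lists A" and cf: "context_free D L"
  shows "context_free A (hom_ext h ` L)"
proof -
  obtain P :: "(nat \<times> (nat, 'c) symbol list) set" and S where fin: "finite P"
    and tms: "\<And>X \<beta>. (X, \<beta>) \<in> P \<Longrightarrow> set \<beta> \<subseteq> range Nt \<union> Tm ` D"
    and L: "L = {w. yields P [Nt S] w}"
    using context_freeE[OF cf] by metis
  define P' where "P' = (\<lambda>(X, \<beta>). (X, hom_ext (subst_tm h) \<beta>)) ` P"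
  define I where "I X = hom_ext h ` {w. yields P [Nt X] w}" for X
  have forward: "yields P' (hom_ext (subst_tm h) \<alpha>) (hom_ext h w)" if "yields P \<alpha> w" for \<alpha> w
    using that
  proof (induction rule: yields.induct)
    case (yields_Tm \<alpha> w a)
    then show ?case by (simp add: yields_append)
  next
    case (yields_Nt X \<beta> u \<alpha> v)
    have "(X, hom_ext (subst_tm h) \<beta>) \<in> P'"
      unfolding P'_def using yields_Nt.hyps(1) by force
    from yields.yields_Nt[OF this yields_Nt.IH] show ?case by simp
  qed (simp add: yields.yields_Nil)
  \<comment> \<open>A word of a translated form is pulled back symbol by symbol; this is what makes
    \<open>I\<close> closed under \<open>P'\<close>.\<close>
  have reflect: "\<exists>w. yields P \<beta> w \<and> u = hom_ext h w" if "in_form I (hom_ext (subst_tm h) \<beta>) u" for \<beta> u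
    using that
  proof (induction \<beta> arbitrary: u)
    case Nil
    then show ?case by (auto intro: yields.yields_Nil)
  next
    case (Cons x \<beta>)
    obtain u1 u2 where u: "u = u1 @ u2" "in_form I (subst_tm h x) u1"
        "in_form I (hom_ext (subst_tm h) \<beta>) u2"
      using Cons.prems by (auto elim: in_form_appendE)
    obtain w2 where w2: "yields P \<beta> w2" "u2 = hom_ext h w2"
      using Cons.IH[OF u(3)] by blast
    have "\<exists>w1. yields P [x] w1 \<and> u1 = hom_ext h w1"
    proof (cases x)
      case (Nt X)
      then show ?thesis using u(2) by (auto simp: I_def)
    next
      case (Tm a)
      then show ?thesis using u(2) by (intro exI[of _ "[a]"]) (auto intro: yields.intros)
    qed
    then obtain w1 where "yields P [x] w1" "u1 = hom_ext h w1" by blast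
    then show ?case
      using w2 u(1) yields_append[of P "[x]" w1 \<beta> w2] by (intro exI[of _ "w1 @ w2"]) simp
  qed
  have "u \<in> I X" if prod: "(X, \<gamma>) \<in> P'" and u: "in_form I \<gamma> u" for X \<gamma> u
  proof -
    obtain \<beta> where "(X, \<beta>) \<in> P" "\<gamma> = hom_ext (subst_tm h) \<beta>"
      using prod by (auto simp: P'_def)
    then show ?thesis using reflect u yields_Nt_single unfolding I_def by fast
  qed
  then have "in_form I [Nt S] w" if "yields P' [Nt S] w" for w
    using that by (rule yields_imp_in_form)
  then have "hom_ext h ` L = {w. yields P' [Nt S] w}"
    using forward[of "[Nt S]"] by (auto simp: L I_def)
  moreover have "set \<gamma> \<subseteq> range Nt \<union> Tm ` A" if prod: "(X, \<gamma>) \<in> P'" for X \<gamma>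
  proof -
    obtain \<beta> where b: "(X, \<beta>) \<in> P" "\<gamma> = hom_ext (subst_tm h) \<beta>"
      using prod by (auto simp: P'_def)
    have "set (subst_tm h x) \<subseteq> range Nt \<union> Tm ` A" if "x \<in> set \<beta>" for x
    proof (cases x)
      case (Tm a)
      then have "a \<in> D" using tms[OF b(1)] that by auto
      then show ?thesis using h Tm by auto
    qed simp
    then show ?thesis using b(2) by fastforce
  qed
  moreover have "finite P'" using fin by (simp add: P'_def)
  ultimately show ?thesis using context_freeI[of P' A S] by simp
qed

section \<open>The buffered grammar for a preimage\<close>

section \<open>Preimages of context-free languages\<close>

locale preimage_grammar =
  fixes A :: "'t set" and D :: "'d set" and h :: "'d \<Rightarrow> 't list"
    and P :: "('n \<times> ('n, 't) symbol list) set" and S :: 'n and N :: nat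
  assumes finA: "finite A" and finD: "finite D" and finP: "finite P"
    and h_lists: "h ` D \<subseteq> lists A"
    and h_length: "c \<in> D \<Longrightarrow> length (h c) \<le> N"
    and tms: "(X, \<beta>) \<in> P \<Longrightarrow> set \<beta> \<subseteq> range Nt \<union> Tm ` A"
begin

text \<open>A buffer holds letters already loaded but not yet matched. Length \<open>N\<close>
  suffices since a cut overhangs by at most the image of one letter.\<close>

definition buffers :: "'t list set" where
  "buffers = {s. set s \<subseteq> A \<and> length s \<le> N}"

text \<open>Right-hand sides are processed from left to right, so only their suffixes arise;
  \<open>[Nt S]\<close> provides the start.\<close>

definition forms :: "('n, 't) symbol list set" where
  "forms = (\<Union>\<beta>\<in>insert [Nt S] (snd ` P). set (suffixes \<beta>))"

text \<open>\<open>s @ h n\<close> may be longer than \<open>N\<close>. Soundness puts no bound on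
  buffers, and the completeness proof loads only where the result is again in
  \<open>buffers\<close>.\<close>

definition load_prods where
  "load_prods = (\<lambda>(s, \<alpha>, s', n). ((s, \<alpha>, s'), [Tm n, Nt (s @ h n, \<alpha>, s')]))
     ` (buffers \<times> forms \<times> buffers \<times> D)"

definition consume_prods where
  "consume_prods = (\<lambda>(a, s, \<alpha>, s'). ((a # s, Tm a # \<alpha>, s'), [Nt (s, \<alpha>, s')]))
     ` (A \<times> buffers \<times> forms \<times> buffers)"

text \<open>\<open>s\<^sub>1\<close> is a guess of the overhang left by the word derived from
  \<open>\<beta>\<close>, handed on to \<open>\<alpha>\<close>.\<close>

definition expand_prods where
  "expand_prods = (\<lambda>(s, (X, \<beta>), s\<^sub>1, \<alpha>, s'). ((s, Nt X # \<alpha>, s'), [Nt (s, \<beta>, s\<^sub>1), Nt (s\<^sub>1, \<alpha>, s')]))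
     ` (buffers \<times> P \<times> buffers \<times> forms \<times> buffers)"

definition stop_prods where
  "stop_prods = (\<lambda>s. ((s, [], s), [])) ` buffers"

definition preimage_prods where
  "preimage_prods = load_prods \<union> consume_prods \<union> expand_prods \<union> stop_prods"

lemma finite_preimage_prods: "finite preimage_prods"
proof -
  have "finite buffers" using finA by (simp add: buffers_def finite_lists_length_le)
  moreover have "finite forms" using finP by (simp add: forms_def)
  ultimately show ?thesis
    using finA finD finP
    by (simp add: preimage_prods_def load_prods_def consume_prods_def expand_prods_def stop_prods_def)
qed

lemma preimage_prods_symbols: "(Y, \<gamma>) \<in> preimage_prods \<Longrightarrow> set \<gamma> \<subseteq> range Nt \<union> Tm ` D"
  by (auto simp: preimage_prods_def load_prods_def consume_prods_def expand_prods_def stop_prods_def)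

lemma forms_tail: "x # \<alpha> \<in> forms \<Longrightarrow> \<alpha> \<in> forms"
  by (auto simp: forms_def dest: suffix_ConsD)

lemma forms_rhs: "(X, \<beta>) \<in> P \<Longrightarrow> \<beta> \<in> forms"
  by (force simp: forms_def)

lemma yields_load:
  assumes "s \<in> buffers" "\<alpha> \<in> forms" "s' \<in> buffers" "n \<in> D"
    and "yields preimage_prods [Nt (s @ h n, \<alpha>, s')] ns"
  shows "yields preimage_prods [Nt (s, \<alpha>, s')] (n # ns)"
proof -
  have "((s, \<alpha>, s'), [Tm n, Nt (s @ h n, \<alpha>, s')]) \<in> preimage_prods"
    using assms(1-4) unfolding preimage_prods_def load_prods_def by force
  then show ?thesis using assms(5) by (auto intro: yields_Nt_single yields_Tm)
qed

text \<open>Once the form is exhausted, the remaining letters are loaded without matching. Every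
  buffer on the way is a prefix of \<open>s'\<close>, hence within bounds.\<close>

lemma yields_stop:
  assumes "ns \<in> lists D" "s \<in> buffers" "s' \<in> buffers" "[] \<in> forms" "s @ hom_ext h ns = s'"
  shows "yields preimage_prods [Nt (s, [], s')] ns"
  using assms
proof (induction ns arbitrary: s rule: lists.induct)
  case Nil
  then have "((s, [], s'), []) \<in> preimage_prods"
    by (auto simp: preimage_prods_def stop_prods_def)
  then show ?case by (auto intro: yields_Nt_single yields_Nil)
next
  case (Cons n ns)
  have "s @ h n \<in> buffers" using Cons.prems(2,4) by (auto simp: buffers_def)
  then show ?case using Cons by (intro yields_load) auto
qed

text \<open>Induction on the derivation tree of \<open>w\<close>: a terminal is matched against the
  front of the buffer, a nonterminal cuts \<open>ns\<close> where its own part of \<open>w\<close>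
  is covered.\<close>

lemma preimage_complete:
  assumes "yields P \<alpha> w" "\<alpha> \<in> forms" "ns \<in> lists D" "s \<in> buffers" "s' \<in> buffers"
    and "s @ hom_ext h ns = w @ s'"
  shows "yields preimage_prods [Nt (s, \<alpha>, s')] ns"
  using assms
proof (induction arbitrary: s s' ns rule: yields.induct)
  case yields_Nil
  then show ?case by (simp add: yields_stop)
next
  case (yields_Tm \<alpha> w a)
  \<comment> \<open>\<open>s\<close> and \<open>ns\<close> are general here because the loading
    phase below changes both before the letter \<open>a\<close> can be matched.\<close>
  have consume: "yields preimage_prods [Nt (a # s, Tm a # \<alpha>, s')] ns"
    if "a # s \<in> buffers" "ns \<in> lists D" "s @ hom_ext h ns = w @ s'" for s ns
  proof -
    have s: "a \<in> A" "s \<in> buffers" using that(1) by (auto simp: buffers_def)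
    have "\<alpha> \<in> forms" using yields_Tm.prems(1) by (rule forms_tail)
    then have "((a # s, Tm a # \<alpha>, s'), [Nt (s, \<alpha>, s')]) \<in> preimage_prods"
      using s yields_Tm.prems(4) unfolding preimage_prods_def consume_prods_def by force
    moreover have "yields preimage_prods [Nt (s, \<alpha>, s')] ns"
      using yields_Tm.IH[OF \<open>\<alpha> \<in> forms\<close> that(2) s(2) yields_Tm.prems(4) that(3)] .
    ultimately show ?thesis by (rule yields_Nt_single)
  qed
  \<comment> \<open>Erasing letters leave an empty buffer empty, so several letters may have to be loaded.\<close>
  from yields_Tm.prems(2,3,5) show ?case
  proof (induction ns arbitrary: s rule: lists.induct)
    case Nil
    then have "s = a # w @ s'" by simp
    then show ?case using consume[of "w @ s'" "[]"] Nil.prems by simp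
  next
    case (Cons n ns)
    show ?case
    proof (cases s)
      case Nil
      have "h n \<in> buffers"
        using h_lists Cons.hyps(1) h_length[OF Cons.hyps(1)] by (auto simp: buffers_def)
      then show ?thesis
        using Nil Cons yields_Tm.prems(1,4) by (intro yields_load) auto
    next
      case (Cons b s\<^sub>1)
      then show ?thesis using consume[of s\<^sub>1 "n # ns"] Cons.prems Cons.hyps by simp
    qed
  qed
next
  case (yields_Nt X \<beta> u \<alpha> v)
  \<comment> \<open>Cutting after \<open>u\<close> yields the overhang \<open>t\<close>, which is
    the intermediate buffer to choose in \<open>expand_prods\<close>.\<close>
  have "s @ hom_ext h ns = u @ (v @ s')" using yields_Nt.prems(5) by simp
  moreover have "length s \<le> N" using yields_Nt.prems(3) by (simp add: buffers_def)
  moreover have "length (h c) \<le> N" if "c \<in> set ns" for c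
    using that yields_Nt.prems(2) h_length by auto
  ultimately obtain x y t where xyt: "ns = x @ y" "s @ hom_ext h x = u @ t"
      "v @ s' = t @ hom_ext h y" "length t \<le> N"
    using hom_ext_split_buffer[of ns h N s u "v @ s'"] by blast
  have xy: "x \<in> lists D" "y \<in> lists D" using xyt(1) yields_Nt.prems(2) by auto
  have "set (u @ t) \<subseteq> A"
    using xyt(2)[symmetric] hom_ext_in_lists[OF h_lists xy(1)] yields_Nt.prems(3)
    by (auto simp: buffers_def)
  then have t: "t \<in> buffers" using xyt(4) by (simp add: buffers_def)
  have \<alpha>: "\<alpha> \<in> forms" using yields_Nt.prems(1) by (rule forms_tail)
  have \<beta>: "\<beta> \<in> forms" using yields_Nt.hyps(1) by (rule forms_rhs)
  have "((s, Nt X # \<alpha>, s'), [Nt (s, \<beta>, t), Nt (t, \<alpha>, s')]) \<in> preimage_prods"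
    using yields_Nt.prems(3,4) yields_Nt.hyps(1) \<alpha> t
    unfolding preimage_prods_def expand_prods_def by force
  moreover have "yields preimage_prods ([Nt (s, \<beta>, t)] @ [Nt (t, \<alpha>, s')]) (x @ y)"
    using yields_Nt.IH(1)[OF \<beta> xy(1) yields_Nt.prems(3) t xyt(2)]
      yields_Nt.IH(2)[OF \<alpha> xy(2) t yields_Nt.prems(4) xyt(3)[symmetric]]
    by (rule yields_append)
  ultimately show ?case using xyt(1) yields_Nt_single by fastforce
qed

text \<open>The intended meaning of the triples, taken as \<open>I\<close>, is closed under all four
  kinds of productions and therefore contains whatever they generate.\<close>

lemma preimage_sound:
  assumes "yields preimage_prods [Nt (s, \<alpha>, s')] ns"
  shows "\<exists>w. yields P \<alpha> w \<and> s @ hom_ext h ns = w @ s'"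
proof -
  define I where "I = (\<lambda>(s, \<alpha>, s'). {ns. \<exists>w. yields P \<alpha> w \<and> s @ hom_ext h ns = w @ s'})"
  have "u \<in> I Y" if prod: "(Y, \<gamma>) \<in> preimage_prods" and u: "in_form I \<gamma> u" for Y \<gamma> u
    using prod unfolding preimage_prods_def
  proof (elim UnE)
    assume "(Y, \<gamma>) \<in> load_prods"
    then show ?thesis using u by (auto simp: load_prods_def I_def)
  next
    assume "(Y, \<gamma>) \<in> consume_prods"
    then obtain a s \<alpha> s' where "Y = (a # s, Tm a # \<alpha>, s')" "\<gamma> = [Nt (s, \<alpha>, s')]"
      by (auto simp: consume_prods_def)
    moreover from this obtain w where "yields P \<alpha> w" "s @ hom_ext h u = w @ s'"
      using u by (auto simp: I_def)
    ultimately show ?thesis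
      using yields_Tm[of P \<alpha> w a] by (auto simp: I_def intro!: exI[of _ "a # w"])
  next
    assume "(Y, \<gamma>) \<in> expand_prods"
    then obtain s X \<beta> t \<alpha> s' where Y: "Y = (s, Nt X # \<alpha>, s')" and X: "(X, \<beta>) \<in> P"
        and \<gamma>: "\<gamma> = [Nt (s, \<beta>, t), Nt (t, \<alpha>, s')]"
      by (auto simp: expand_prods_def)
    obtain x y v w where "u = x @ y" and v: "yields P \<beta> v" "s @ hom_ext h x = v @ t"
        and w: "yields P \<alpha> w" "t @ hom_ext h y = w @ s'"
      using u by (auto simp: \<gamma> I_def)
    \<comment> \<open>The two equations are chained through the shared buffer
      \<open>t\<close>.\<close>
    then have "s @ hom_ext h u = (v @ w) @ s'"
      by (metis append.assoc concat_append map_append)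
    then show ?thesis
      using yields_Nt[OF X v(1) w(1)] unfolding Y I_def by blast
  next
    assume "(Y, \<gamma>) \<in> stop_prods"
    then show ?thesis using u by (auto simp: stop_prods_def I_def intro: yields_Nil)
  qed
  then have "in_form I [Nt (s, \<alpha>, s')] ns"
    using assms by (rule yields_imp_in_form)
  then show ?thesis by (auto simp: I_def)
qed

text \<open>With both buffers empty, the equation between buffers and words says that
  \<open>hom_ext h x\<close> itself is derived from \<open>[Nt S]\<close>.\<close>

lemma preimage_language:
  "{x \<in> lists D. yields P [Nt S] (hom_ext h x)} = {x. yields preimage_prods [Nt ([], [Nt S], [])] x}"
proof (intro equalityI subsetI CollectI)
  fix x assume "x \<in> {x \<in> lists D. yields P [Nt S] (hom_ext h x)}"
  then show "yields preimage_prods [Nt ([], [Nt S], [])] x"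
    by (intro preimage_complete[of _ "hom_ext h x"]) (auto simp: forms_def buffers_def)
next
  fix x assume "x \<in> {x. yields preimage_prods [Nt ([], [Nt S], [])] x}"
  then have x: "yields preimage_prods [Nt ([], [Nt S], [])] x" by simp
  then have "x \<in> lists D"
    using yields_set_subset[OF preimage_prods_symbols x] by simp
  moreover have "yields P [Nt S] (hom_ext h x)"
    using preimage_sound[OF x] by auto
  ultimately show "x \<in> lists D \<and> yields P [Nt S] (hom_ext h x)" by blast
qed

lemma context_free_preimage: "context_free D {x \<in> lists D. yields P [Nt S] (hom_ext h x)}"
  unfolding preimage_language
  using finite_preimage_prods preimage_prods_symbols by (rule context_freeI)

end

lemma context_free_hom_preimage:
  fixes h :: "'d \<Rightarrow> 't list"
  assumes "finite A" and "finite D" and h: "h ` D \<subseteq> lists A" and cf: "context_free A K"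
  shows "context_free D {x \<in> lists D. hom_ext h x \<in> K}"
proof -
  obtain P :: "(nat \<times> (nat, 't) symbol list) set" and S where fin: "finite P"
    and tms: "\<And>X \<beta>. (X, \<beta>) \<in> P \<Longrightarrow> set \<beta> \<subseteq> range Nt \<union> Tm ` A"
    and K: "K = {w. yields P [Nt S] w}"
    using context_freeE[OF cf] by metis
  obtain N where N: "\<And>c. c \<in> D \<Longrightarrow> length (h c) \<le> N"
    using finite_imp_bounded_length[OF \<open>finite D\<close>] by blast
  interpret preimage_grammar A D h P S N
    using assms(1-3) fin tms N by unfold_locales
  show ?thesis using context_free_preimage by (simp add: K)
qed

section \<open>The byte language as an image and the token language as a preimage\<close>

section \<open>Byte-level tokenization\<close>

text \<open>A token string tokenizes exactly one byte string, the concatenation of its tokens, so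
  the union over \<open>K\<close> is a preimage.\<close>

lemma token_language_eq:
  "token_language V \<tau> K = {ns \<in> lists (token_ids V). hom_ext \<tau> ns \<in> K}"
  by (auto simp: token_language_def tokenizations_def)

theorem mainTheorem6:
  fixes \<Sigma> :: "'c set"
    and enc :: "'c \<Rightarrow> nat list"
    and V :: "nat list set"
    and \<tau> :: "nat \<Rightarrow> nat list"
    and L :: "'c list set"
  assumes "finite \<Sigma>"
    and "encoding_scheme \<Sigma> enc"
    and "byte_level_tokenizer V \<tau>"
    and "L \<subseteq> lists \<Sigma>"
  shows "(context_free \<Sigma> L \<longrightarrow>
            context_free bytes (byte_language enc L) \<and>
            context_free (token_ids V) (token_language V \<tau> (byte_language enc L))) \<and>
         (regular \<Sigma> L \<longrightarrow>
            regular bytes (byte_language enc L) \<and>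
            regular (token_ids V) (token_language V \<tau> (byte_language enc L)))"
proof -
  have bytes: "finite bytes" and ids: "finite (token_ids V)"
    by (simp_all add: bytes_def token_ids_def)
  have enc: "enc ` \<Sigma> \<subseteq> lists bytes"
    using assms(2) by (auto simp: encoding_scheme_def)
  have tok: "\<tau> ` token_ids V \<subseteq> lists bytes"
    using assms(3) by (auto simp: byte_level_tokenizer_def bij_betw_def)
  have byte: "byte_language enc L = hom_ext enc ` L"
    by (simp add: byte_language_def encode_def)
  \<comment> \<open>The image results give the claim for the byte language; the preimage results are
    then applied to that language, with token IDs as domain alphabet and bytes as target.\<close>
  show ?thesis
    unfolding token_language_eq
    using context_free_hom_image[OF enc] context_free_hom_preimage[OF bytes ids tok]
      regular_hom_image[OF assms(1) bytes enc] regular_hom_preimage[OF tok]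
    by (simp add: byte)
qed

end
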